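(* Let $(R,\mathfrak{m},k)$ be a complete local domain of mixed characteristic $p$ with $F$-finite residue field $k$. Then $\tau_{\mathrm{epf}}(R)=0$.
   Context: All rings (other than $R^+$) are commutative Noetherian. Mixed characteristic $p$ means $R$ has characteristic $0$ and its residue field has characteristic $p>0$. For a domain $R$, the absolute integral closure $R^+$ is the integral closure of $R$ in an algebraic closure of its fraction field. Full extended plus closure (epf): let $R$ be a mixed characteristic local domain whose residue field has characteristic $p$, and let $N\subseteq M$ be $R$-modules. Then $N_M^{\mathrm{epf}}$ is the set of $u\in M$ for which there exists a nonzero $c\in R$ such that for all positive integers $n$, $$c^{1/n}\otimes u\in \operatorname{im}\left(R^+\otimes_R N+R^+\otimes_R p^nM\to R^+\otimes_R M\right),$$ where $c^{1/n}\in R^+$ denotes an $n$-th root of $c$, and the image is the sum of the images of $R^+\otimes_R N$ and $R^+\otimes_R p^nM$ in $R^+\otimes_R M$. The (big) test ideal of a closure operation $\mathrm{cl}$ is $\tau_{\mathrm{cl}}(R)=\bigcap_{N\subseteq M} (N:_R N_M^{\mathrm{cl}})$, the intersection being over all pairs of $R$-modules $N\subseteq M$ (not necessarily finitely generated). *)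

theory Defs
  imports "HOL-Algebra.Algebra" "HOL-Library.Equipollence"
begin

section \<open>Complete local domains of mixed characteristic\<close>

definition local_ring :: "('a, 'b) ring_scheme \<Rightarrow> 'a set \<Rightarrow> bool"
  where "local_ring R \<mm> \<longleftrightarrow> cring R \<and> {I. maximalideal I R} = {\<mm>}"

definition ring_char :: "('a, 'b) ring_scheme \<Rightarrow> nat"
  where "ring_char R =
    (if \<exists>n > 0. add_pow R (n::nat) \<one>\<^bsub>R\<^esub> = \<zero>\<^bsub>R\<^esub>
     then (LEAST n. n > 0 \<and> add_pow R n \<one>\<^bsub>R\<^esub> = \<zero>\<^bsub>R\<^esub>) else 0)"

definition mixed_characteristic :: "('a, 'b) ring_scheme \<Rightarrow> 'a set \<Rightarrow> nat \<Rightarrow> bool"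
  where "mixed_characteristic R \<mm> p \<longleftrightarrow> ring_char R = 0 \<and> ring_char (R Quot \<mm>) = p \<and> p > 0"

primrec ideal_power :: "('a, 'b) ring_scheme \<Rightarrow> 'a set \<Rightarrow> nat \<Rightarrow> 'a set"
  where
    "ideal_power R I 0 = carrier R"
  | "ideal_power R I (Suc n) = ideal_prod R (ideal_power R I n) I"

text \<open>The inverse limit of the rings $R/I^n$.  The elements of $R/I^n$ are cosets, and the
  transition map sends a coset of $I^{n+1}$ to the coset of $I^n$ containing it.\<close>

definition adic_limit :: "('a, 'b) ring_scheme \<Rightarrow> 'a set \<Rightarrow> (nat \<Rightarrow> 'a set) set"
  where "adic_limit R I =
    {W. \<forall>n. W n \<in> carrier (R Quot (ideal_power R I n)) \<and> W (Suc n) \<subseteq> W n}"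

definition adically_complete :: "('a, 'b) ring_scheme \<Rightarrow> 'a set \<Rightarrow> bool"
  where "adically_complete R I \<longleftrightarrow>
    bij_betw (\<lambda>a n. ideal_power R I n +>\<^bsub>R\<^esub> a) (carrier R) (adic_limit R I)"

text \<open>For a field \<open>K\<close> of characteristic \<open>p\<close>: the Frobenius map is finite, that is,
  \<open>K\<close> has finite degree over its subfield of \<open>p\<close>-th powers.\<close>

definition F_finite_field :: "('a, 'b) ring_scheme \<Rightarrow> nat \<Rightarrow> bool"
  where "F_finite_field K p \<longleftrightarrow>
    ring.finite_dimension K ((\<lambda>x. x [^]\<^bsub>K\<^esub> p) ` carrier K) (carrier K)"


section \<open>The field of fractions\<close>

text \<open>\<open>ring_frac R a b\<close> is the fraction $a/b$, as an equivalence class of pairs.\<close>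

definition ring_frac :: "('a, 'b) ring_scheme \<Rightarrow> 'a \<Rightarrow> 'a \<Rightarrow> ('a \<times> 'a) set"
  where "ring_frac R a b = {(x, y). x \<in> carrier R \<and> y \<in> carrier R - {\<zero>\<^bsub>R\<^esub>} \<and>
                               x \<otimes>\<^bsub>R\<^esub> b = a \<otimes>\<^bsub>R\<^esub> y}"

text \<open>In the operations below all members of the union are the same fraction.\<close>

definition fraction_field :: "('a, 'b) ring_scheme \<Rightarrow> ('a \<times> 'a) set ring"
  where "fraction_field R =
    \<lparr> carrier = (\<Union>a \<in> carrier R. \<Union>b \<in> carrier R - {\<zero>\<^bsub>R\<^esub>}. {ring_frac R a b}),
      monoid.mult = (\<lambda>W Y. \<Union>(a, b) \<in> W. \<Union>(c, d) \<in> Y. ring_frac R (a \<otimes>\<^bsub>R\<^esub> c) (b \<otimes>\<^bsub>R\<^esub> d)),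
      one = ring_frac R \<one>\<^bsub>R\<^esub> \<one>\<^bsub>R\<^esub>,
      ring.zero = ring_frac R \<zero>\<^bsub>R\<^esub> \<one>\<^bsub>R\<^esub>,
      ring.add = (\<lambda>W Y. \<Union>(a, b) \<in> W. \<Union>(c, d) \<in> Y.
               ring_frac R (a \<otimes>\<^bsub>R\<^esub> d \<oplus>\<^bsub>R\<^esub> c \<otimes>\<^bsub>R\<^esub> b) (b \<otimes>\<^bsub>R\<^esub> d)) \<rparr>"

lemma UN_pair_const:
  assumes "z \<in> A" "w \<in> B" "\<And>x y u v. (x, y) \<in> A \<Longrightarrow> (u, v) \<in> B \<Longrightarrow> F x y u v = C"
  shows "(\<Union>(x, y) \<in> A. \<Union>(u, v) \<in> B. F x y u v) = C"
proof -
  have "(\<Union>(u, v) \<in> B. F x y u v) = C" if "(x, y) \<in> A" for x y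
    using that by (intro UN_constant_eq[OF assms(2)]) (auto simp: assms(3))
  then have "(case z of (x, y) \<Rightarrow> \<Union>(u, v) \<in> B. F x y u v) = C" if "z \<in> A" for z
    using that by (cases z) (simp only: prod.case)
  then show ?thesis
    by (intro UN_constant_eq[OF assms(1)]) blast
qed

context domain
begin

lemma frac_eq_iff:
  assumes "a \<in> carrier R" "b \<in> carrier R - {\<zero>}" "c \<in> carrier R" "d \<in> carrier R - {\<zero>}"
  shows "ring_frac R a b = ring_frac R c d \<longleftrightarrow> a \<otimes> d = c \<otimes> b"
proof
  assume "ring_frac R a b = ring_frac R c d"
  moreover have "(a, b) \<in> ring_frac R a b"
    using assms by (auto simp: ring_frac_def)
  ultimately show "a \<otimes> d = c \<otimes> b"
    by (auto simp: ring_frac_def)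
next
  have sub: "ring_frac R a b \<subseteq> ring_frac R c d"
    if h: "a \<in> carrier R" "b \<in> carrier R - {\<zero>}" "c \<in> carrier R" "d \<in> carrier R - {\<zero>}"
      "a \<otimes> d = c \<otimes> b" for a b c d
  proof
    fix z assume "z \<in> ring_frac R a b"
    then obtain x y where z: "z = (x, y)" and xy: "x \<in> carrier R" "y \<in> carrier R - {\<zero>}"
      "x \<otimes> b = a \<otimes> y"
      by (auto simp: ring_frac_def)
    have "b \<otimes> (x \<otimes> d) = (x \<otimes> b) \<otimes> d"
      using xy(1,2) h(1-4) by (simp add: m_ac)
    also have "\<dots> = (a \<otimes> d) \<otimes> y"
      unfolding xy(3) using xy(1,2) h(1-4) by (auto simp: m_ac)
    also have "\<dots> = b \<otimes> (c \<otimes> y)"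
      unfolding h(5) using xy(1,2) h(1-4) by (auto simp: m_ac)
    finally have "x \<otimes> d = c \<otimes> y"
      using xy(1,2) h(1-4) by (simp add: m_lcancel)
    then show "z \<in> ring_frac R c d"
      using z xy by (auto simp: ring_frac_def)
  qed
  assume "a \<otimes> d = c \<otimes> b"
  then show "ring_frac R a b = ring_frac R c d"
    using sub[of a b c d] sub[of c d a b] assms by auto
qed

lemma frac_mem:
  assumes "a \<in> carrier R" "b \<in> carrier R - {\<zero>}" "(x, y) \<in> ring_frac R a b"
  shows "x \<in> carrier R" "y \<in> carrier R" "y \<noteq> \<zero>" "x \<otimes> b = a \<otimes> y"
  using assms by (auto simp: ring_frac_def)

lemma frac_self:
  assumes "a \<in> carrier R" "b \<in> carrier R - {\<zero>}"
  shows "(a, b) \<in> ring_frac R a b"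
  using assms by (auto simp: ring_frac_def)

lemma frac_mult:
  assumes "a \<in> carrier R" "b \<in> carrier R - {\<zero>}" "c \<in> carrier R" "d \<in> carrier R - {\<zero>}"
  shows "ring_frac R a b \<otimes>\<^bsub>fraction_field R\<^esub> ring_frac R c d = ring_frac R (a \<otimes> c) (b \<otimes> d)"
proof -
  have *: "ring_frac R (x \<otimes> u) (y \<otimes> v) = ring_frac R (a \<otimes> c) (b \<otimes> d)"
    if "(x, y) \<in> ring_frac R a b" "(u, v) \<in> ring_frac R c d" for x y u v
  proof -
    note 1 = frac_mem[OF assms(1,2) that(1)] and 2 = frac_mem[OF assms(3,4) that(2)]
    have "(x \<otimes> u) \<otimes> (b \<otimes> d) = (x \<otimes> b) \<otimes> (u \<otimes> d)"
      using 1(1-3) 2(1-3) assms by (simp add: m_ac)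
    also have "\<dots> = (a \<otimes> c) \<otimes> (y \<otimes> v)"
      unfolding 1(4) 2(4) using 1(1-3) 2(1-3) assms by (simp add: m_ac)
    finally show ?thesis
      using 1(1-3) 2(1-3) assms by (subst frac_eq_iff) (auto simp: integral_iff)
  qed
  show ?thesis
    unfolding fraction_field_def
    by (simp, rule UN_pair_const[OF frac_self[OF assms(1,2)] frac_self[OF assms(3,4)] *])
qed

lemma frac_add:
  assumes "a \<in> carrier R" "b \<in> carrier R - {\<zero>}" "c \<in> carrier R" "d \<in> carrier R - {\<zero>}"
  shows "ring_frac R a b \<oplus>\<^bsub>fraction_field R\<^esub> ring_frac R c d = ring_frac R (a \<otimes> d \<oplus> c \<otimes> b) (b \<otimes> d)"
proof -
  have *: "ring_frac R (x \<otimes> v \<oplus> u \<otimes> y) (y \<otimes> v) = ring_frac R (a \<otimes> d \<oplus> c \<otimes> b) (b \<otimes> d)"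
    if "(x, y) \<in> ring_frac R a b" "(u, v) \<in> ring_frac R c d" for x y u v
  proof -
    note 1 = frac_mem[OF assms(1,2) that(1)] and 2 = frac_mem[OF assms(3,4) that(2)]
    have "(x \<otimes> v \<oplus> u \<otimes> y) \<otimes> (b \<otimes> d) = (x \<otimes> b) \<otimes> (v \<otimes> d) \<oplus> (u \<otimes> d) \<otimes> (y \<otimes> b)"
      using 1(1-3) 2(1-3) assms by (simp add: m_ac l_distr r_distr)
    also have "\<dots> = (a \<otimes> d \<oplus> c \<otimes> b) \<otimes> (y \<otimes> v)"
      unfolding 1(4) 2(4) using 1(1-3) 2(1-3) assms by (simp add: m_ac l_distr r_distr)
    finally show ?thesis
      using 1(1-3) 2(1-3) assms by (subst frac_eq_iff) (auto simp: integral_iff)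
  qed
  show ?thesis
    unfolding fraction_field_def
    by (simp, rule UN_pair_const[OF frac_self[OF assms(1,2)] frac_self[OF assms(3,4)] *])
qed

lemma frac_closed:
  "a \<in> carrier R \<Longrightarrow> b \<in> carrier R - {\<zero>} \<Longrightarrow> ring_frac R a b \<in> carrier (fraction_field R)"
  by (auto simp: fraction_field_def)

lemma fracE:
  assumes "W \<in> carrier (fraction_field R)"
  obtains a b where "a \<in> carrier R" "b \<in> carrier R - {\<zero>}" "W = ring_frac R a b"
  using assms by (auto simp: fraction_field_def)

lemma fraction_field_zero: "\<zero>\<^bsub>fraction_field R\<^esub> = ring_frac R \<zero> \<one>"
  and fraction_field_one: "\<one>\<^bsub>fraction_field R\<^esub> = ring_frac R \<one> \<one>"
  by (simp_all add: fraction_field_def)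

lemmas fraction_simps = frac_mult frac_add frac_closed fraction_field_zero fraction_field_one
  integral_iff

lemma field_fraction_field: "field (fraction_field R)"
proof -
  let ?K = "fraction_field R"
  have cr: "cring ?K"
  proof (rule cringI)
    show "abelian_group ?K"
    proof (rule abelian_groupI)
      fix W Y Z assume "W \<in> carrier ?K" "Y \<in> carrier ?K" "Z \<in> carrier ?K"
      then obtain a b c d e f where h: "a \<in> carrier R" "b \<in> carrier R - {\<zero>}" "W = ring_frac R a b"
        "c \<in> carrier R" "d \<in> carrier R - {\<zero>}" "Y = ring_frac R c d"
        "e \<in> carrier R" "f \<in> carrier R - {\<zero>}" "Z = ring_frac R e f"
        by (elim fracE)
      then show "(W \<oplus>\<^bsub>?K\<^esub> Y) \<oplus>\<^bsub>?K\<^esub> Z = W \<oplus>\<^bsub>?K\<^esub> (Y \<oplus>\<^bsub>?K\<^esub> Z)"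
        by (simp add: fraction_simps a_ac m_ac l_distr r_distr)
    next
      fix W Y assume "W \<in> carrier ?K" "Y \<in> carrier ?K"
      then obtain a b c d where h: "a \<in> carrier R" "b \<in> carrier R - {\<zero>}" "W = ring_frac R a b"
        "c \<in> carrier R" "d \<in> carrier R - {\<zero>}" "Y = ring_frac R c d"
        by (elim fracE)
      then show "W \<oplus>\<^bsub>?K\<^esub> Y \<in> carrier ?K"
        by (simp add: fraction_simps)
      from h show "W \<oplus>\<^bsub>?K\<^esub> Y = Y \<oplus>\<^bsub>?K\<^esub> W"
        by (simp add: fraction_simps a_ac m_ac l_distr r_distr)
    next
      fix W assume "W \<in> carrier ?K"
      then obtain a b where h: "a \<in> carrier R" "b \<in> carrier R - {\<zero>}" "W = ring_frac R a b"
        by (elim fracE)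
      then show "\<zero>\<^bsub>?K\<^esub> \<oplus>\<^bsub>?K\<^esub> W = W"
        by (simp add: fraction_simps)
      have "ring_frac R (\<ominus> a) b \<oplus>\<^bsub>?K\<^esub> W = \<zero>\<^bsub>?K\<^esub>"
        using h by (simp add: fraction_simps frac_eq_iff l_minus l_neg)
      then show "\<exists>Y\<in>carrier ?K. Y \<oplus>\<^bsub>?K\<^esub> W = \<zero>\<^bsub>?K\<^esub>"
        using h by (intro bexI[of _ "ring_frac R (\<ominus> a) b"]) (simp_all add: frac_closed)
    qed (simp add: fraction_simps)
    show "Group.comm_monoid ?K"
    proof (rule comm_monoidI)
      fix W Y Z assume "W \<in> carrier ?K" "Y \<in> carrier ?K" "Z \<in> carrier ?K"
      then obtain a b c d e f where h: "a \<in> carrier R" "b \<in> carrier R - {\<zero>}" "W = ring_frac R a b"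
        "c \<in> carrier R" "d \<in> carrier R - {\<zero>}" "Y = ring_frac R c d"
        "e \<in> carrier R" "f \<in> carrier R - {\<zero>}" "Z = ring_frac R e f"
        by (elim fracE)
      then show "(W \<otimes>\<^bsub>?K\<^esub> Y) \<otimes>\<^bsub>?K\<^esub> Z = W \<otimes>\<^bsub>?K\<^esub> (Y \<otimes>\<^bsub>?K\<^esub> Z)"
        by (simp add: fraction_simps m_ac)
    next
      fix W Y assume "W \<in> carrier ?K" "Y \<in> carrier ?K"
      then obtain a b c d where h: "a \<in> carrier R" "b \<in> carrier R - {\<zero>}" "W = ring_frac R a b"
        "c \<in> carrier R" "d \<in> carrier R - {\<zero>}" "Y = ring_frac R c d"
        by (elim fracE)
      then show "W \<otimes>\<^bsub>?K\<^esub> Y \<in> carrier ?K"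
        by (simp add: fraction_simps)
      from h show "W \<otimes>\<^bsub>?K\<^esub> Y = Y \<otimes>\<^bsub>?K\<^esub> W"
        by (simp add: fraction_simps m_ac)
    next
      fix W assume "W \<in> carrier ?K"
      then obtain a b where h: "a \<in> carrier R" "b \<in> carrier R - {\<zero>}" "W = ring_frac R a b"
        by (elim fracE)
      then show "\<one>\<^bsub>?K\<^esub> \<otimes>\<^bsub>?K\<^esub> W = W"
        by (simp add: fraction_simps)
    qed (simp add: fraction_simps)
    fix W Y Z assume "W \<in> carrier ?K" "Y \<in> carrier ?K" "Z \<in> carrier ?K"
    then obtain a b c d e f where h: "a \<in> carrier R" "b \<in> carrier R - {\<zero>}" "W = ring_frac R a b"
      "c \<in> carrier R" "d \<in> carrier R - {\<zero>}" "Y = ring_frac R c d"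
      "e \<in> carrier R" "f \<in> carrier R - {\<zero>}" "Z = ring_frac R e f"
      by (elim fracE)
    then show "(W \<oplus>\<^bsub>?K\<^esub> Y) \<otimes>\<^bsub>?K\<^esub> Z = W \<otimes>\<^bsub>?K\<^esub> Z \<oplus>\<^bsub>?K\<^esub> Y \<otimes>\<^bsub>?K\<^esub> Z"
      by (simp add: fraction_simps frac_eq_iff a_ac m_ac l_distr r_distr)
  qed
  show ?thesis
  proof (rule cring.cring_fieldI2[OF cr])
    show "\<zero>\<^bsub>?K\<^esub> \<noteq> \<one>\<^bsub>?K\<^esub>"
      by (simp add: fraction_simps frac_eq_iff)
    fix W assume "W \<in> carrier ?K" and nz: "W \<noteq> \<zero>\<^bsub>?K\<^esub>"
    then obtain a b where h: "a \<in> carrier R" "b \<in> carrier R - {\<zero>}" "W = ring_frac R a b"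
      by (elim fracE)
    with nz have a: "a \<in> carrier R - {\<zero>}"
      by (auto simp: fraction_simps frac_eq_iff)
    have "W \<otimes>\<^bsub>?K\<^esub> ring_frac R b a = \<one>\<^bsub>?K\<^esub>"
      using h a by (simp add: fraction_simps frac_eq_iff m_comm)
    then show "\<exists>Y\<in>carrier ?K. W \<otimes>\<^bsub>?K\<^esub> Y = \<one>\<^bsub>?K\<^esub>"
      using h a by (intro bexI[of _ "ring_frac R b a"]) (simp_all add: frac_closed)
  qed
qed

lemma frac_ring_hom: "(\<lambda>r. ring_frac R r \<one>) \<in> ring_hom R (fraction_field R)"
  by (rule ring_hom_memI) (simp_all add: fraction_simps)

lemma frac_inj: "inj_on (\<lambda>r. ring_frac R r \<one>) (carrier R)"
  by (rule inj_onI) (simp add: frac_eq_iff)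

end


section \<open>The absolute integral closure\<close>

definition integral_over :: "('a, 'b) ring_scheme \<Rightarrow> 'a set \<Rightarrow> 'a \<Rightarrow> bool"
  where "integral_over L A x \<longleftrightarrow>
    (\<exists>f \<in> carrier (univ_poly L A). f \<noteq> [] \<and> lead_coeff f = \<one>\<^bsub>L\<^esub> \<and> ring.eval L f x = \<zero>\<^bsub>L\<^esub>)"

text \<open>The type of the elements of the library's algebraic closure of \<open>fraction_field R\<close>.\<close>

type_synonym 'a plus_elem =
  "(('a \<times> 'a) set list \<times> nat) multiset \<Rightarrow> ('a \<times> 'a) set"

definition fraction_closure :: "('a, 'b) ring_scheme \<Rightarrow> 'a plus_elem ring"
  where "fraction_closure R = field.alg_closure (fraction_field R)"

definition to_plus :: "('a, 'b) ring_scheme \<Rightarrow> 'a \<Rightarrow> 'a plus_elem"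
  where "to_plus R r = ring.indexed_const (fraction_field R) (ring_frac R r \<one>\<^bsub>R\<^esub>)"

text \<open>$R^+$ as an \<open>R\<close>-algebra: the record carries both its ring structure and the
  scalar multiplication by elements of \<open>R\<close>.\<close>

definition plus_closure :: "('a, 'b) ring_scheme \<Rightarrow> ('a, 'a plus_elem) module"
  where "plus_closure R =
    \<lparr> carrier = {x \<in> carrier (fraction_closure R).
                   integral_over (fraction_closure R) (to_plus R ` carrier R) x},
      monoid.mult = monoid.mult (fraction_closure R),
      one = \<one>\<^bsub>fraction_closure R\<^esub>,
      ring.zero = \<zero>\<^bsub>fraction_closure R\<^esub>,
      ring.add = ring.add (fraction_closure R),
      smult = (\<lambda>r x. to_plus R r \<otimes>\<^bsub>fraction_closure R\<^esub> x) \<rparr>"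


section \<open>Tensor products of modules\<close>

text \<open>\<open>P \<otimes>\<^sub>R M\<close> is the free abelian group on \<open>P \<times> M\<close> modulo the subgroup generated by
  the bilinearity relations.  Only its additive group is needed.\<close>

definition tensor_free :: "('a, 'p, 's) module_scheme \<Rightarrow> ('a, 'm, 't) module_scheme \<Rightarrow>
    (('p \<times> 'm) \<Rightarrow>\<^sub>0 int) monoid"
  where "tensor_free P M = free_Abelian_group (carrier P \<times> carrier M)"

definition tensor_relations :: "('a, 'b) ring_scheme \<Rightarrow> ('a, 'p, 's) module_scheme \<Rightarrow>
    ('a, 'm, 't) module_scheme \<Rightarrow> (('p \<times> 'm) \<Rightarrow>\<^sub>0 int) set"
  where "tensor_relations R P M = generate (tensor_free P M)
    ({frag_of (s \<oplus>\<^bsub>P\<^esub> t, x) - frag_of (s, x) - frag_of (t, x) | s t x.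
        s \<in> carrier P \<and> t \<in> carrier P \<and> x \<in> carrier M} \<union>
     {frag_of (s, x \<oplus>\<^bsub>M\<^esub> y) - frag_of (s, x) - frag_of (s, y) | s x y.
        s \<in> carrier P \<and> x \<in> carrier M \<and> y \<in> carrier M} \<union>
     {frag_of (r \<odot>\<^bsub>P\<^esub> s, x) - frag_of (s, r \<odot>\<^bsub>M\<^esub> x) | r s x.
        r \<in> carrier R \<and> s \<in> carrier P \<and> x \<in> carrier M})"

definition tensor :: "('a, 'b) ring_scheme \<Rightarrow> ('a, 'p, 's) module_scheme \<Rightarrow>
    ('a, 'm, 't) module_scheme \<Rightarrow> (('p \<times> 'm) \<Rightarrow>\<^sub>0 int) set monoid"
  where "tensor R P M = tensor_free P M Mod tensor_relations R P M"

definition pure_tensor :: "('a, 'b) ring_scheme \<Rightarrow> ('a, 'p, 's) module_scheme \<Rightarrow>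
    ('a, 'm, 't) module_scheme \<Rightarrow> 'p \<Rightarrow> 'm \<Rightarrow> (('p \<times> 'm) \<Rightarrow>\<^sub>0 int) set"
  where "pure_tensor R P M s x = tensor_relations R P M #>\<^bsub>tensor_free P M\<^esub> frag_of (s, x)"

text \<open>For a submodule \<open>N\<close> of \<open>M\<close>, the image of \<open>P \<otimes>\<^sub>R N \<rightarrow> P \<otimes>\<^sub>R M\<close>.  The map sends a coset of the
  relations for \<open>N\<close> to the coset of the (more numerous) relations for \<open>M\<close> that contains it.\<close>

definition tensor_image :: "('a, 'b) ring_scheme \<Rightarrow> ('a, 'p, 's) module_scheme \<Rightarrow>
    ('a, 'm, 't) module_scheme \<Rightarrow> 'm set \<Rightarrow> (('p \<times> 'm) \<Rightarrow>\<^sub>0 int) set set"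
  where "tensor_image R P M N =
    (\<lambda>W. tensor_relations R P M <#>\<^bsub>tensor_free P M\<^esub> W) ` carrier (tensor R P (M\<lparr>carrier := N\<rparr>))"


section \<open>Full extended plus closure and test ideals\<close>

definition int_multiples :: "nat \<Rightarrow> ('a, 'm, 't) module_scheme \<Rightarrow> 'm set"
  where "int_multiples k M = (\<lambda>x. add_pow M k x) ` carrier M"

text \<open>The epf closure of \<open>N\<close> in \<open>M\<close>, where \<open>p\<close> is the residue characteristic of \<open>R\<close>.  Two
  \<open>n\<close>-th roots of \<open>c\<close> differ by a unit of $R^+$, so the choice of the root \<open>r\<close> is immaterial.\<close>

definition epf_closure :: "('a, 'b) ring_scheme \<Rightarrow> nat \<Rightarrow> ('a, 'm) module \<Rightarrow> 'm set \<Rightarrow> 'm set"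
  where "epf_closure R p M N =
    {u \<in> carrier M. \<exists>c \<in> carrier R - {\<zero>\<^bsub>R\<^esub>}. \<forall>n > (0::nat).
       \<exists>r \<in> carrier (plus_closure R). r [^]\<^bsub>plus_closure R\<^esub> n = to_plus R c \<and>
         pure_tensor R (plus_closure R) M r u \<in>
           tensor_image R (plus_closure R) M N <#>\<^bsub>tensor R (plus_closure R) M\<^esub>
           tensor_image R (plus_closure R) M (int_multiples (p ^ n) M)}"

definition module_colon :: "('a, 'b) ring_scheme \<Rightarrow> ('a, 'm, 't) module_scheme \<Rightarrow>
    'm set \<Rightarrow> 'm set \<Rightarrow> 'a set"
  where "module_colon R M N U = {a \<in> carrier R. \<forall>u \<in> U. a \<odot>\<^bsub>M\<^esub> u \<in> N}"

text \<open>The intersection of \<open>N :\<^sub>R N\<^sup>c\<^sup>l\<close> over all \<open>R\<close>-modules \<open>M\<close> and all submodules \<open>N\<close> of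
  \<open>M\<close>.  HOL cannot quantify over all types, so the carriers of the modules are taken in a
  universe \<open>'m\<close>.  For the epf closure any infinite universe into which \<open>R\<close> embeds gives the
  intersection over all modules whatsoever: a failure of \<open>a \<odot> u \<in> N\<close> with \<open>u\<close> in the closure of
  \<open>N\<close> only involves, for each \<open>n\<close>, finitely many elements of \<open>M\<close>, hence already occurs in a
  countably generated submodule of \<open>M\<close>.  In a universe that is too small (such as \<open>unit\<close>) the
  intersection is larger.\<close>

definition test_ideal :: "('a, 'b) ring_scheme \<Rightarrow> (('a, 'm) module \<Rightarrow> 'm set \<Rightarrow> 'm set) \<Rightarrow> 'a set"
  where "test_ideal R cl =
    carrier R \<inter> \<Inter> {module_colon R M N (cl M N) | M N. module R M \<and> submodule N R M}"

definition epf_test_ideal :: "'m itself \<Rightarrow> ('a, 'b) ring_scheme \<Rightarrow> nat \<Rightarrow> 'a set"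
  where "epf_test_ideal _ R p =
    test_ideal R (epf_closure R p :: ('a, 'm) module \<Rightarrow> 'm set \<Rightarrow> 'm set)"

end

theory Submission
  imports Defs
begin

text \<open>If \<open>p\<close> acts surjectively on a module \<open>M\<close>, then $p^n M = M$ for all \<open>n\<close>, and the membership
  defining the epf closure holds for every \<open>u\<close>, already with \<open>c = 1\<close>; so every submodule of \<open>M\<close>
  has epf closure \<open>M\<close>.  The fraction field of \<open>R\<close> is such a module because \<open>R\<close> has
  characteristic \<open>0\<close>, and only \<open>0\<close> multiplies it into its zero submodule.  Since \<open>R\<close> is
  infinite, its fraction field fits into any universe containing \<open>R\<close>.\<close>

section \<open>Constants of \<open>R\<close> in $R^+$\<close>

context domain
begin

lemma field_fraction_closure: "field (fraction_closure R)"
  and to_plus_hom: "to_plus R \<in> ring_hom R (fraction_closure R)"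
proof -
  interpret K: field "fraction_field R"
    by (rule field_fraction_field)
  have "algebraic_closure (fraction_closure R) (K.indexed_const ` carrier (fraction_field R))"
    unfolding fraction_closure_def by (rule K.alg_closureE)
  then show "field (fraction_closure R)"
    unfolding algebraic_closure_def by blast
  have "to_plus R = K.indexed_const \<circ> (\<lambda>r. ring_frac R r \<one>)"
    by (simp add: to_plus_def fun_eq_iff)
  then show "to_plus R \<in> ring_hom R (fraction_closure R)"
    unfolding fraction_closure_def
    using ring_hom_trans[OF frac_ring_hom K.alg_closureE(2)] by simp
qed

text \<open>The image of \<open>r\<close> is a root of the monic linear polynomial
  \<open>X - r\<close>, written as \<open>?f\<close> with the leading coefficient first.\<close>

lemma to_plus_mem_plus_closure:
  assumes "r \<in> carrier R"
  shows "to_plus R r \<in> carrier (plus_closure R)"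
proof -
  interpret L: field "fraction_closure R"
    by (rule field_fraction_closure)
  interpret h: ring_hom_ring R "fraction_closure R" "to_plus R"
    by (intro ring_hom_ringI2 to_plus_hom ring_axioms L.ring_axioms)
  let ?f = "[\<one>\<^bsub>fraction_closure R\<^esub>, to_plus R (\<ominus> r)]"
  have "to_plus R \<one> \<in> to_plus R ` carrier R" "to_plus R (\<ominus> r) \<in> to_plus R ` carrier R"
    using assms by blast+
  then have "?f \<in> carrier (univ_poly (fraction_closure R) (to_plus R ` carrier R))"
    by (simp add: univ_poly_def polynomial_def)
  moreover have "L.eval ?f (to_plus R r) = \<zero>\<^bsub>fraction_closure R\<^esub>"
    using assms by (simp add: L.r_neg)
  ultimately have "integral_over (fraction_closure R) (to_plus R ` carrier R) (to_plus R r)"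
    unfolding integral_over_def by (intro bexI[of _ ?f]) auto
  then show ?thesis
    using assms by (simp add: plus_closure_def)
qed

lemma to_plus_one: "to_plus R \<one> = \<one>\<^bsub>plus_closure R\<^esub>"
  using ring_hom_one[OF to_plus_hom] by (simp add: plus_closure_def)

text \<open>\<open>plus_closure R\<close> takes its multiplication and unit from the ambient field,
  so the power can be computed there without first showing that \<open>plus_closure R\<close> is a
  ring.\<close>

lemma one_nat_pow_plus_closure:
  "\<one>\<^bsub>plus_closure R\<^esub> [^]\<^bsub>plus_closure R\<^esub> (n::nat) = \<one>\<^bsub>plus_closure R\<^esub>"
proof -
  interpret L: field "fraction_closure R"
    by (rule field_fraction_closure)
  have "x [^]\<^bsub>plus_closure R\<^esub> n = x [^]\<^bsub>fraction_closure R\<^esub> n" for x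
    by (simp add: nat_pow_def plus_closure_def)
  moreover have "\<one>\<^bsub>plus_closure R\<^esub> = \<one>\<^bsub>fraction_closure R\<^esub>"
    by (simp add: plus_closure_def)
  ultimately show ?thesis
    by simp
qed

end


section \<open>Images in tensor products\<close>

text \<open>If the keys of \<open>h\<close> lie in \<open>T\<close>, both inverses are
  \<open>-h\<close>. Otherwise \<open>h\<close> has an inverse in neither group, and both sides are
  the same unspecified value.\<close>

lemma inv_free_Abelian_group_mono:
  assumes "S \<subseteq> T" "Poly_Mapping.keys h \<inter> T \<subseteq> S"
  shows "inv\<^bsub>free_Abelian_group S\<^esub> h = inv\<^bsub>free_Abelian_group T\<^esub> h"
proof (cases "Poly_Mapping.keys h \<subseteq> T")
  case True
  with assms have "Poly_Mapping.keys h \<subseteq> S"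
    by blast
  with True show ?thesis
    by (simp add: inv_free_Abelian_group)
next
  case False
  \<comment> \<open>Any \<open>y\<close> inverse to \<open>h\<close> has the keys of
    \<open>h\<close>, so it lies outside both carriers and \<open>m_inv\<close> becomes a
    description with an empty predicate in both groups.\<close>
  have "h + y = 0 \<Longrightarrow> Poly_Mapping.keys y = Poly_Mapping.keys h" for y
    by (metis add_eq_0_iff keys_minus)
  with False assms(1)
  have "(\<lambda>y. Poly_Mapping.keys y \<subseteq> S \<and> h + y = 0 \<and> y + h = 0) = (\<lambda>y. False)"
    "(\<lambda>y. Poly_Mapping.keys y \<subseteq> T \<and> h + y = 0 \<and> y + h = 0) = (\<lambda>y. False)"
    by blast+
  then show ?thesis
    by (simp add: m_inv_def)
qed

text \<open>Unit and multiplication agree in the two free groups. Only inverses of generators could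
  differ, and the condition on keys excludes that.\<close>

lemma generate_free_Abelian_group_mono:
  assumes "S \<subseteq> T" "A \<subseteq> B" "\<And>h. h \<in> A \<Longrightarrow> Poly_Mapping.keys h \<inter> T \<subseteq> S"
  shows "generate (free_Abelian_group S) A \<subseteq> generate (free_Abelian_group T) B"
proof
  fix x assume "x \<in> generate (free_Abelian_group S) A"
  then show "x \<in> generate (free_Abelian_group T) B"
  proof induction
    case one
    then show ?case
      using generate.one[of "free_Abelian_group T" B] by simp
  next
    case (incl h)
    with assms(2) show ?case
      by (auto intro: generate.incl)
  next
    case (inv h)
    with assms(2) have "inv\<^bsub>free_Abelian_group T\<^esub> h \<in> generate (free_Abelian_group T) B"
      by (auto intro: generate.inv)
    with inv show ?case
      by (simp add: inv_free_Abelian_group_mono[OF assms(1,3)])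
  next
    case (eng h k)
    then show ?case
      using generate.eng[of h "free_Abelian_group T" B k] by simp
  qed
qed

text \<open>No closure properties of \<open>P\<close> are assumed, so the generating relations may fall outside the
  carrier of the free group, where the inverse is a junk value: it has to be the same one for
  both modules.  This avoids proving that $R^+$ is closed under addition.\<close>

lemma tensor_relations_submodule_subset:
  fixes P :: "('a, 'p, 's) module_scheme" and M :: "('a, 'm, 't) module_scheme"
  assumes "module R M" "submodule N R M"
  shows "tensor_relations R P (M\<lparr>carrier := N\<rparr>) \<subseteq> tensor_relations R P M"
proof -
  interpret module R M by fact
  note N = submoduleE[OF assms(2)]
  show ?thesis
    unfolding tensor_relations_def tensor_free_def
  proof (rule generate_free_Abelian_group_mono, goal_cases)
    case 1
    then show ?case using N(1) by auto
  next
    case 2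
    show ?case
      using N(1) by (intro Un_mono; intro Collect_mono; simp; blast)
  next
    case (3 h)
    \<comment> \<open>First components stay unconstrained, since sums and multiples in
      \<open>P\<close> may leave its carrier. Only the second components decide what remains after
      intersecting with the larger index set.\<close>
    have mem3: "Poly_Mapping.keys (frag_of a - frag_of b - frag_of c) \<subseteq> UNIV \<times> N"
      if "snd a \<in> N" "snd b \<in> N" "snd c \<in> N" for a b c :: "'p \<times> 'm"
      using that keys_diff[of "frag_of a - frag_of b" "frag_of c"] keys_diff[of "frag_of a" "frag_of b"]
      by (cases a; cases b; cases c) auto
    have mem2: "Poly_Mapping.keys (frag_of a - frag_of b) \<subseteq> UNIV \<times> N"
      if "snd a \<in> N" "snd b \<in> N" for a b :: "'p \<times> 'm"
      using that keys_diff[of "frag_of a" "frag_of b"] by (cases a; cases b) auto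
    from 3 have "Poly_Mapping.keys h \<subseteq> UNIV \<times> N"
      using N(4,5) by (elim UnE CollectE exE conjE; hypsubst) (intro mem2 mem3; simp)+
    then show ?case
      by auto
  qed
qed

lemma zero_mem_tensor_relations: "0 \<in> tensor_relations R P M"
  using generate.one[of "tensor_free P M"] by (simp add: tensor_relations_def tensor_free_def)

lemma tensor_relations_add:
  "h \<in> tensor_relations R P M \<Longrightarrow> k \<in> tensor_relations R P M \<Longrightarrow> h + k \<in> tensor_relations R P M"
  using generate.eng[of h "tensor_free P M" _ k] by (simp add: tensor_relations_def tensor_free_def)

text \<open>Adding \<open>B\<close> gains nothing because the relations are closed under addition,
  and loses nothing because \<open>B\<close> contains 0.\<close>

lemma tensor_relations_absorb:
  assumes "0 \<in> B" "B \<subseteq> tensor_relations R P M"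
  shows "tensor_relations R P M <#>\<^bsub>tensor_free P M\<^esub> B = tensor_relations R P M"
    (is "?T <#>\<^bsub>?F\<^esub> B = ?T")
proof
  have *: "?T <#>\<^bsub>?F\<^esub> B = {h + k |h k. h \<in> ?T \<and> k \<in> B}"
    unfolding set_mult_def tensor_free_def by auto
  show "?T <#>\<^bsub>?F\<^esub> B \<subseteq> ?T"
    unfolding * using assms(2) by (blast intro: tensor_relations_add)
  show "?T \<subseteq> ?T <#>\<^bsub>?F\<^esub> B"
  proof
    fix h assume "h \<in> ?T"
    with assms(1) have "h + 0 \<in> ?T <#>\<^bsub>?F\<^esub> B"
      unfolding * by blast
    then show "h \<in> ?T <#>\<^bsub>?F\<^esub> B"
      by simp
  qed
qed

text \<open>This serves twice: the map behind \<open>tensor_image\<close> fixes every coset when the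
  submodule is all of \<open>M\<close>, and the relations are a left unit of the tensor
  product.\<close>

lemma tensor_relations_absorb_coset:
  "tensor_relations R P M <#>\<^bsub>tensor_free P M\<^esub> (tensor_relations R P M #>\<^bsub>tensor_free P M\<^esub> x)
     = tensor_relations R P M #>\<^bsub>tensor_free P M\<^esub> x"
    (is "?T <#>\<^bsub>?F\<^esub> (?T #>\<^bsub>?F\<^esub> x) = _")
proof -
  have coset: "B #>\<^bsub>?F\<^esub> x = {h + x |h. h \<in> B}" for B
    unfolding r_coset_def tensor_free_def by auto
  have "?T <#>\<^bsub>?F\<^esub> (?T #>\<^bsub>?F\<^esub> x) = {h + (k + x) |h k. h \<in> ?T \<and> k \<in> ?T}"
    unfolding coset unfolding set_mult_def tensor_free_def by auto
  also have "\<dots> = (?T <#>\<^bsub>?F\<^esub> ?T) #>\<^bsub>?F\<^esub> x"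
    unfolding coset unfolding set_mult_def tensor_free_def by (auto simp: add.assoc[symmetric])
  also have "\<dots> = ?T #>\<^bsub>?F\<^esub> x"
    by (simp add: tensor_relations_absorb zero_mem_tensor_relations)
  finally show ?thesis .
qed

text \<open>The pure tensor is written as zero, coming from \<open>N\<close>, plus itself, coming
  from the whole of \<open>M\<close>.\<close>

lemma pure_tensor_mem_images:
  assumes "module R M" "submodule N R M" "s \<in> carrier P" "u \<in> carrier M"
  shows "pure_tensor R P M s u \<in>
    tensor_image R P M N <#>\<^bsub>tensor R P M\<^esub> tensor_image R P M (carrier M)"
proof -
  let ?T = "tensor_relations R P M" and ?B = "tensor_relations R P (M\<lparr>carrier := N\<rparr>)"
  let ?F = "tensor_free P M" and ?x = "frag_of (s, u)"
  have "?B #>\<^bsub>tensor_free P (M\<lparr>carrier := N\<rparr>)\<^esub> 0 = ?B"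
    by (simp add: r_coset_def tensor_free_def)
  then have "?B \<in> carrier (tensor R P (M\<lparr>carrier := N\<rparr>))"
    by (auto simp: tensor_def FactGroup_def RCOSETS_def tensor_free_def intro!: exI[of _ 0])
  then have "?T <#>\<^bsub>?F\<^esub> ?B \<in> tensor_image R P M N"
    unfolding tensor_image_def by blast
  \<comment> \<open>The zero coset for \<open>N\<close> is sent to the zero coset for
    \<open>M\<close>.\<close>
  then have N: "?T \<in> tensor_image R P M N"
    using tensor_relations_absorb[OF zero_mem_tensor_relations
        tensor_relations_submodule_subset[OF assms(1,2)]] by metis
  have "?T #>\<^bsub>?F\<^esub> ?x \<in> carrier (tensor R P M)"
    using assms by (auto simp: tensor_def FactGroup_def RCOSETS_def tensor_free_def)
  then have "?T <#>\<^bsub>?F\<^esub> (?T #>\<^bsub>?F\<^esub> ?x) \<in> tensor_image R P M (carrier M)"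
    unfolding tensor_image_def by simp
  then have M: "?T #>\<^bsub>?F\<^esub> ?x \<in> tensor_image R P M (carrier M)"
    by (simp only: tensor_relations_absorb_coset)
  have "pure_tensor R P M s u = ?T \<otimes>\<^bsub>tensor R P M\<^esub> (?T #>\<^bsub>?F\<^esub> ?x)"
    by (simp add: pure_tensor_def tensor_def FactGroup_def tensor_relations_absorb_coset)
  with N M show ?thesis
    by (auto simp: set_mult_def)
qed

text \<open>For \<open>c = 1\<close> the root 1 serves for every \<open>n\<close>, and divisibility
  turns the second image into that of all of \<open>M\<close>.\<close>

lemma (in domain) epf_closure_divisible_module:
  fixes M :: "('a, 'm) module"
  assumes "module R M" "submodule N R M" "\<And>n. int_multiples (p ^ n) M = carrier M"
  shows "epf_closure R p M N = carrier M"
proof -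
  have "\<exists>r\<in>carrier (plus_closure R). r [^]\<^bsub>plus_closure R\<^esub> (n::nat) = to_plus R \<one> \<and>
      pure_tensor R (plus_closure R) M r u \<in> tensor_image R (plus_closure R) M N
        <#>\<^bsub>tensor R (plus_closure R) M\<^esub>
        tensor_image R (plus_closure R) M (int_multiples (p ^ n) M)"
    if "u \<in> carrier M" for u n
    using that to_plus_mem_plus_closure[of \<one>] assms
    by (intro bexI[of _ "to_plus R \<one>"])
      (simp_all add: to_plus_one one_nat_pow_plus_closure pure_tensor_mem_images)
  then show ?thesis
    unfolding epf_closure_def by (fastforce intro: bexI[of _ \<one>])
qed


section \<open>The fraction field as a module\<close>

text \<open>The map \<open>h\<close> is arbitrary because the fraction field will be replaced by a
  copy of it in the universe of modules.\<close>

definition restrict_scalars :: "('a \<Rightarrow> 'm) \<Rightarrow> ('m, 'c) ring_scheme \<Rightarrow> ('a, 'm) module"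
  where "restrict_scalars h L =
    \<lparr> carrier = carrier L, monoid.mult = monoid.mult L, one = \<one>\<^bsub>L\<^esub>, ring.zero = \<zero>\<^bsub>L\<^esub>,
      ring.add = ring.add L, smult = (\<lambda>r x. h r \<otimes>\<^bsub>L\<^esub> x) \<rparr>"

lemma restrict_scalars_simps [simp]:
  "carrier (restrict_scalars h L) = carrier L"
  "\<zero>\<^bsub>restrict_scalars h L\<^esub> = \<zero>\<^bsub>L\<^esub>"
  "x \<oplus>\<^bsub>restrict_scalars h L\<^esub> y = x \<oplus>\<^bsub>L\<^esub> y"
  "r \<odot>\<^bsub>restrict_scalars h L\<^esub> x = h r \<otimes>\<^bsub>L\<^esub> x"
  by (simp_all add: restrict_scalars_def)

lemma add_pow_restrict_scalars:
  "add_pow (restrict_scalars h L) (n::nat) x = add_pow L n x"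
  by (simp add: add_pow_def nat_pow_def restrict_scalars_def)

lemma module_restrict_scalars:
  assumes "cring R" "ring L" "h \<in> ring_hom R L"
  shows "module R (restrict_scalars h L)"
proof -
  interpret R: cring R by fact
  interpret L: ring L by fact
  interpret h: ring_hom_ring R L h
    by (intro ring_hom_ringI2 assms R.ring_axioms)
  show ?thesis
  proof (rule moduleI)
    show "abelian_group (restrict_scalars h L)"
      by (rule abelian_groupI) (auto simp: L.a_assoc intro: L.a_comm bexI[of _ "\<ominus>\<^bsub>L\<^esub> _"] L.l_neg)
  qed (simp_all add: L.l_distr L.r_distr L.m_assoc assms)
qed

lemma (in module) zero_submodule: "submodule {\<zero>\<^bsub>M\<^esub>} R M"
  by (rule submoduleI) (auto simp: smult_r_null)

section \<open>Characteristic zero, divisibility and cardinality\<close>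

lemma ring_char_eq_0D:
  assumes "ring_char R = 0" "n > 0"
  shows "add_pow R (n::nat) \<one>\<^bsub>R\<^esub> \<noteq> \<zero>\<^bsub>R\<^esub>"
proof
  assume "add_pow R n \<one>\<^bsub>R\<^esub> = \<zero>\<^bsub>R\<^esub>"
  with assms(2) have *: "\<exists>n>0. add_pow R (n::nat) \<one>\<^bsub>R\<^esub> = \<zero>\<^bsub>R\<^esub>"
    by blast
  \<comment> \<open>The least annihilating number is positive, so \<open>ring_char\<close> could not
    be 0.\<close>
  from LeastI_ex[OF this] show False
    using assms(1) * by (simp add: ring_char_def)
qed

text \<open>The multiples of \<one> are pairwise distinct: if two coincided, the difference of their
  indices would annihilate \<one>.\<close>

lemma (in ring) infinite_carrier_if_char_0:
  assumes "ring_char R = 0"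
  shows "infinite (carrier R)"
proof -
  have "i = j" if "add_pow R i \<one> = add_pow R j \<one>" "i \<le> j" for i j :: nat
  proof (rule ccontr)
    assume "i \<noteq> j"
    have "add_pow R i \<one> \<oplus> add_pow R (j - i) \<one> = add_pow R i \<one>"
      using that add.nat_pow_mult[of \<one> i "j - i"] by simp
    then have "add_pow R (j - i) \<one> = \<zero>"
      by (simp add: add.l_cancel_one)
    with ring_char_eq_0D[OF assms, of "j - i"] that \<open>i \<noteq> j\<close> show False
      by simp
  qed
  then have "inj (\<lambda>n::nat. add_pow R n \<one>)"
    by (intro injI) (metis nat_le_linear)
  moreover have "range (\<lambda>n::nat. add_pow R n \<one>) \<subseteq> carrier R"
    by auto
  ultimately show ?thesis
    using finite_imageD finite_subset infinite_UNIV_nat by blast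
qed

text \<open>Injectivity of \<open>h\<close> carries characteristic 0 over to \<open>L\<close>, so
  \<open>?k\<close> is invertible and every \<open>x\<close> can be divided by it.\<close>

lemma int_multiples_restrict_scalars:
  assumes "ring R" "field L" "h \<in> ring_hom R L" "inj_on h (carrier R)" "ring_char R = 0" "k > 0"
  shows "int_multiples k (restrict_scalars h L) = carrier L"
proof -
  interpret R: ring R by fact
  interpret L: field L by fact
  interpret h: ring_hom_ring R L h
    by (intro ring_hom_ringI2 assms L.ring_axioms)
  let ?k = "add_pow L k \<one>\<^bsub>L\<^esub>"
  have hpow: "h (add_pow R n \<one>\<^bsub>R\<^esub>) = add_pow L n \<one>\<^bsub>L\<^esub>" for n :: nat
    by (induction n) simp_all
  have "?k \<noteq> \<zero>\<^bsub>L\<^esub>"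
  proof
    assume "?k = \<zero>\<^bsub>L\<^esub>"
    then have "h (add_pow R k \<one>\<^bsub>R\<^esub>) = h \<zero>\<^bsub>R\<^esub>"
      by (simp add: hpow)
    then have "add_pow R k \<one>\<^bsub>R\<^esub> = \<zero>\<^bsub>R\<^esub>"
      by (rule inj_onD[OF assms(4)]) simp_all
    with ring_char_eq_0D[OF assms(5,6)] show False ..
  qed
  then have k: "?k \<in> Units L"
    by (simp add: L.field_Units)
  have "x \<in> (\<lambda>x. add_pow L k x) ` carrier L" if "x \<in> carrier L" for x
  proof (rule image_eqI)
    have "add_pow L k (inv\<^bsub>L\<^esub> ?k \<otimes>\<^bsub>L\<^esub> x) = ?k \<otimes>\<^bsub>L\<^esub> (inv\<^bsub>L\<^esub> ?k \<otimes>\<^bsub>L\<^esub> x)"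
      using that k by (simp add: L.add_pow_ldistr)
    also have "\<dots> = x"
      using that k by (simp add: L.m_assoc[symmetric])
    finally show "x = add_pow L k (inv\<^bsub>L\<^esub> ?k \<otimes>\<^bsub>L\<^esub> x)" ..
  qed (use that k in simp)
  then show ?thesis
    by (auto simp: int_multiples_def add_pow_restrict_scalars)
qed

text \<open>Fractions are images of pairs, and an infinite set is equipollent to its square.\<close>

lemma (in domain) fraction_field_lepoll:
  assumes "infinite (carrier R)"
  shows "carrier (fraction_field R) \<lesssim> carrier R"
proof -
  have "carrier (fraction_field R) \<subseteq> (\<lambda>(a, b). ring_frac R a b) ` (carrier R \<times> carrier R)"
    by (auto simp: fraction_field_def)
  then have "carrier (fraction_field R) \<lesssim> carrier R \<times> carrier R"
    unfolding lepoll_iff by blast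
  also have "carrier R \<times> carrier R \<approx> carrier R"
    using card_of_Times_same_infinite[OF assms] by (simp add: eqpoll_iff_card_of_ordIso)
  finally show ?thesis .
qed

theorem theorem3p2:
  fixes R :: "('a, 'b) ring_scheme" and \<mm> :: "'a set" and p :: nat
  assumes "noetherian_domain R"
    and "local_ring R \<mm>"
    and "adically_complete R \<mm>"
    and "mixed_characteristic R \<mm> p"
    and "F_finite_field (R Quot \<mm>) p"
    and universe: "carrier R \<lesssim> (UNIV :: 'm set)"
  shows "epf_test_ideal TYPE('m) R p = {\<zero>\<^bsub>R\<^esub>}"
proof -
  interpret domain R
    using assms(1) by (rule noetherian_domain.axioms)
  have char: "ring_char R = 0" and p: "p > 0"
    using assms(4) by (simp_all add: mixed_characteristic_def)
  interpret K: field "fraction_field R"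
    by (rule field_fraction_field)
  have "carrier (fraction_field R) \<lesssim> (UNIV :: 'm set)"
    using lepoll_trans[OF fraction_field_lepoll universe] infinite_carrier_if_char_0[OF char] .
  then obtain g :: "('a \<times> 'a) set \<Rightarrow> 'm" where g: "inj_on g (carrier (fraction_field R))"
    by (auto simp: lepoll_def)
  \<comment> \<open>\<open>L\<close> is the fraction field transported along \<open>g\<close>, so
    that its elements have type \<open>'m\<close>.\<close>
  define L where "L = image_ring g (fraction_field R)"
  define h where "h = g \<circ> (\<lambda>r. ring_frac R r \<one>\<^bsub>R\<^esub>)"
  interpret L: field L
    unfolding L_def by (rule K.inj_imp_image_ring_is_field[OF g])
  have "g \<in> ring_hom (fraction_field R) L"
    using inj_imp_image_ring_iso[OF g] by (simp add: ring_iso_def L_def)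
  with frac_ring_hom have h: "h \<in> ring_hom R L"
    unfolding h_def by (rule ring_hom_trans)
  interpret h: ring_hom_ring R L h
    by (intro ring_hom_ringI2 h ring_axioms L.ring_axioms)
  have h_inj: "inj_on h (carrier R)"
    unfolding h_def by (intro comp_inj_on frac_inj inj_on_subset[OF g]) (auto intro: frac_closed)
  let ?M = "restrict_scalars h L"
  have M: "module R ?M"
    by (rule module_restrict_scalars) (intro is_cring L.ring_axioms h)+
  have N: "submodule {\<zero>\<^bsub>L\<^esub>} R ?M"
    using module.zero_submodule[OF M] by simp
  have closure: "epf_closure R p ?M {\<zero>\<^bsub>L\<^esub>} = carrier L"
    \<comment> \<open>Since \<open>p > 0\<close>, every \<open>p ^ n\<close> is positive, including
      \<open>n = 0\<close>, and acts surjectively on \<open>L\<close>.\<close>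
    using epf_closure_divisible_module[OF M N, of p] p
    by (simp add: int_multiples_restrict_scalars[OF ring_axioms L.field_axioms h h_inj char])
  have "a = \<zero>\<^bsub>R\<^esub>" if "a \<in> epf_test_ideal TYPE('m) R p" for a
  proof -
    \<comment> \<open>For this pair the closure is everything, so the colon is the annihilator of
      \<open>L\<close>; testing it on the unit of \<open>L\<close> gives
      \<open>h a = 0\<close>.\<close>
    have "module_colon R ?M {\<zero>\<^bsub>L\<^esub>} (carrier L) \<in>
        {module_colon R M' N' (epf_closure R p M' N') | (M' :: ('a, 'm) module) N'.
          module R M' \<and> submodule N' R M'}"
      unfolding closure[symmetric] by (intro CollectI exI[of _ ?M] exI[of _ "{\<zero>\<^bsub>L\<^esub>}"] conjI refl M N)
    from InterD[OF _ this, of a] that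
    have a: "a \<in> carrier R" and "a \<in> module_colon R ?M {\<zero>\<^bsub>L\<^esub>} (carrier L)"
      by (simp_all add: epf_test_ideal_def test_ideal_def)
    then have "h a \<otimes>\<^bsub>L\<^esub> \<one>\<^bsub>L\<^esub> = \<zero>\<^bsub>L\<^esub>"
      by (force simp: module_colon_def)
    with a have "h a = h \<zero>\<^bsub>R\<^esub>"
      by simp
    from inj_onD[OF h_inj this] a show ?thesis
      by simp
  qed
  \<comment> \<open>For the reverse inclusion, 0 sends every element of a closure to the zero of
    \<open>M'\<close>, which lies in \<open>N'\<close>.\<close>
  moreover have "\<zero>\<^bsub>R\<^esub> \<in> module_colon R M' N' (epf_closure R p M' N')"
    if "module R M'" "submodule N' R M'" for M' :: "('a, 'm) module" and N'
  proof -
    interpret M': module R M' by fact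
    have "\<zero>\<^bsub>M'\<^esub> \<in> N'"
      using subgroup.one_closed[OF submodule.axioms(1)[OF that(2)]] by simp
    then show ?thesis
      by (auto simp: module_colon_def epf_closure_def)
  qed
  then have "\<zero>\<^bsub>R\<^esub> \<in> epf_test_ideal TYPE('m) R p"
    by (auto simp: epf_test_ideal_def test_ideal_def)
  ultimately show ?thesis
    by blast
qed

end
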